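(* $\mathfrak{hp}'\leq\mathfrak{l}$.
   Context: A compactification $\alpha\omega$ of the countable discrete space $\omega$ is a compact Hausdorff space containing $\omega$ as a dense subspace. $\alpha\omega\leq\gamma\omega$ means there is a continuous surjection $f:\gamma\omega\to\alpha\omega$ whose restriction to $\omega$ is the identity; $\alpha\omega\simeq\gamma\omega$ means such an $f$ can be chosen to be a homeomorphism. Modulo $\simeq$, compactifications of $\omega$ ordered by $\leq$ form a complete upper semilattice with largest element the Stone–Čech compactification $\beta\omega$; $\sup$ is taken in it. $C_{\alpha\omega}$ denotes the set of bounded functions $\omega\to\mathbb{R}$ that extend continuously over $\alpha\omega$; it determines $\alpha\omega$ up to $\simeq$, and every subring of the ring of bounded functions on $\omega$ that is closed in the uniform norm, contains all constants and generates the topology of $\omega$ is of this form. A metric $d$ on $\omega$ is proper if each $d$-bounded set has compact closure. $\mathrm{PM}(\omega)$ is the set of all proper metrics on $\omega$ compatible with the discrete topology. For $d\in\mathrm{PM}(\omega)$, a function $f:\omega\to\mathbb{R}$ is slowly oscillating with respect to $d$ if for all $r>0$ and $\varepsilon>0$ there is a compact (i.e. finite) $K\subseteq\omega$ such that $\mathrm{diam}\, f[\mathrm{B}_d(x,r)]<\varepsilon$ for all $x\in\omega\setminus K$. $C^*_d(\omega)$ is the ring of all bounded slowly oscillating functions from $(\omega,d)$ to $\mathbb{R}$, and the Higson compactification $\overline{\omega}^d$ is the compactification with $C_{\overline{\omega}^d}=C^*_d(\omega)$. $\mathrm{PM}'(\omega)$ is the set of $d\in\mathrm{PM}(\omega)$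 with $\beta\omega\not\simeq\overline{\omega}^d$. For such metrics, $d_1\sqsubseteq d_2$ means $C^*_{d_1}(\omega)\subseteq C^*_{d_2}(\omega)$ (equivalently $\overline{\omega}^{d_1}\leq\overline{\omega}^{d_2}$). $\mathfrak{hp}'$ is the smallest cardinality of a set $D\subseteq\mathrm{PM}'(\omega)$ that is directed with respect to $\sqsubseteq$ (for any $d_1,d_2\in D$ there is $d\in D$ with $d_1\sqsubseteq d$ and $d_2\sqsubseteq d$) and satisfies $\beta\omega\simeq\sup\{\overline{\omega}^d: d\in D\}$. $\mathcal{S}=\prod_{n<\omega}[\omega]^{\leq n+1}$; its elements are called slaloms. $\mathfrak{l}$ is the smallest cardinal $\kappa$ such that for every $h\in\omega^\omega$ there is a set $\Phi\subseteq\mathcal{S}$ of size $\kappa$ such that for every $f\in\prod_{n<\omega}h(n)$ there is $\varphi\in\Phi$ with $f(n)\in\varphi(n)$ for all but finitely many $n<\omega$ (here $h(n)=\{0,\dots,h(n)-1\}$). Convention: if no set of the required kind exists, the cardinal being defined is $\infty$, and $\lambda<\infty$ for every cardinal $\lambda$. *)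

theory Defs
  imports "HOL-Analysis.Analysis"
begin

unbundle cardinal_syntax
no_notation Set_Algebras.elt_set_eq (infix "=o" 50)

section \<open>Compactifications of the discrete space \<open>\<omega>\<close>\<close>

text \<open>
  A compactification is given by its topology together with the inclusion of \<open>\<omega>\<close>.
\<close>

type_synonym 'a extension = "'a topology \<times> (nat \<Rightarrow> 'a)"

definition compactification :: "'a extension \<Rightarrow> bool" where
  "compactification \<alpha> \<longleftrightarrow>
     compact_space (fst \<alpha>) \<and> Hausdorff_space (fst \<alpha>) \<and>
     embedding_map (discrete_topology UNIV) (fst \<alpha>) (snd \<alpha>) \<and>
     fst \<alpha> closure_of range (snd \<alpha>) = topspace (fst \<alpha>)"

definition comp_le :: "'a extension \<Rightarrow> 'b extension \<Rightarrow> bool" where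
  "comp_le \<alpha> \<gamma> \<longleftrightarrow>
     (\<exists>f. continuous_map (fst \<gamma>) (fst \<alpha>) f \<and> f ` topspace (fst \<gamma>) = topspace (fst \<alpha>) \<and>
          (\<forall>n. f (snd \<gamma> n) = snd \<alpha> n))"

definition comp_equiv :: "'a extension \<Rightarrow> 'b extension \<Rightarrow> bool" where
  "comp_equiv \<alpha> \<gamma> \<longleftrightarrow>
     (\<exists>f. homeomorphic_map (fst \<gamma>) (fst \<alpha>) f \<and> (\<forall>n. f (snd \<gamma> n) = snd \<alpha> n))"

definition ext_functions :: "'a extension \<Rightarrow> (nat \<Rightarrow> real) set" where
  "ext_functions \<alpha> =
     {f. bounded (range f) \<and>
         (\<exists>g. continuous_map (fst \<alpha>) euclideanreal g \<and> (\<forall>n. g (snd \<alpha> n) = f n))}"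

text \<open>
  To range over all compactifications up to equivalence we fix the carrier type
  \<^typ>\<open>nat set set\<close>.  This loses nothing: a point of a compactification is determined by the
  traces on \<open>\<omega>\<close> of its open neighbourhoods, so that every compactification, on whatever type,
  has an equivalent copy on this type (lemma \<open>compactification_copy\<close>).
\<close>

type_synonym comp = "nat set set extension"

lemma compactification_copy:
  fixes \<alpha> :: "'a extension"
  assumes "compactification \<alpha>"
  shows "\<exists>\<gamma> :: comp. compactification \<gamma> \<and> comp_equiv \<gamma> \<alpha>"
proof -
  obtain X e where \<alpha>: "\<alpha> = (X, e)" by (cases \<alpha>)
  have cpt: "compact_space X" and H: "Hausdorff_space X"
    and emb: "embedding_map (discrete_topology UNIV) X e"
    and dense: "X closure_of range e = topspace X"
    using assms by (auto simp: compactification_def \<alpha>)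
  define t where "t x = {e -` U |U. openin X U \<and> x \<in> U}" for x
  have inj: "inj_on t (topspace X)"
  proof (rule inj_onI, rule ccontr)
    fix x y assume x: "x \<in> topspace X" and y: "y \<in> topspace X" and eq: "t x = t y" and "x \<noteq> y"
    then obtain U V where UV: "openin X U" "openin X V" "x \<in> U" "y \<in> V" "disjnt U V"
      using H unfolding Hausdorff_space_def by metis
    have "e -` U \<in> t y" using UV eq unfolding t_def by blast
    then obtain W where W: "openin X W" "y \<in> W" "e -` U = e -` W"
      unfolding t_def by blast
    have "openin X (W \<inter> V)" "y \<in> W \<inter> V" using UV W by auto
    moreover have "y \<in> X closure_of range e" using y dense by simp
    ultimately obtain n where "e n \<in> W \<inter> V" unfolding in_closure_of by blast
    then show False using W UV unfolding disjnt_def by blast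
  qed
  define i where "i = inv_into (topspace X) t"
  define Y where "Y = pullback_topology (t ` topspace X) i X"
  have it: "i (t x) = x" if "x \<in> topspace X" for x
    using inj that by (simp add: i_def)
  have topY: "topspace Y = t ` topspace X"
    unfolding Y_def topspace_pullback_topology by (auto simp: it)
  have cont_i: "continuous_map Y X i"
    unfolding Y_def using continuous_map_pullback [OF continuous_map_id, where f = i and A = "t ` topspace X"]
    by simp
  have cont_t: "continuous_map X Y t"
    unfolding Y_def
  proof (rule continuous_map_pullback')
    show "continuous_map X X (i \<circ> t)"
      by (rule continuous_map_eq [OF continuous_map_id]) (simp add: it)
  qed auto
  have hom: "homeomorphic_map X Y t"
    by (rule homeomorphic_maps_imp_map [where g = i])
      (use cont_i cont_t it in \<open>auto simp: homeomorphic_maps_def topY\<close>)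
  have ran: "range e \<subseteq> topspace X"
    using emb homeomorphic_imp_surjective_map [of "discrete_topology UNIV" _ e]
    unfolding embedding_map_def by (metis Int_lower1 topspace_discrete_topology topspace_subtopology)
  have "embedding_map X Y t"
    using hom homeomorphic_imp_surjective_map [OF hom] by (simp add: embedding_map_def)
  have "compactification (Y, t \<circ> e)"
    unfolding compactification_def fst_conv snd_conv
  proof (intro conjI)
    show "compact_space Y"
      using cpt hom homeomorphic_compact_space homeomorphic_map_imp_homeomorphic_space by blast
    show "Hausdorff_space Y"
      using H hom homeomorphic_Hausdorff_space homeomorphic_map_imp_homeomorphic_space by blast
    show "embedding_map (discrete_topology UNIV) Y (t \<circ> e)"
      using emb \<open>embedding_map X Y t\<close> embedding_map_compose by blast
    show "Y closure_of range (t \<circ> e) = topspace Y"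
      using homeomorphic_map_closure_of [OF hom ran] dense topY by (simp add: image_comp)
  qed
  moreover have "comp_equiv (Y, t \<circ> e) \<alpha>"
    using hom unfolding comp_equiv_def \<alpha> by auto
  ultimately show ?thesis by blast
qed

text \<open>
  The following are defined only up to \<^const>\<open>comp_equiv\<close>; the choice operator picks a
  representative.
\<close>

definition stone_cech :: comp where
  "stone_cech = (SOME \<beta>. compactification \<beta> \<and> (\<forall>\<alpha> :: comp. compactification \<alpha> \<longrightarrow> comp_le \<alpha> \<beta>))"

definition comp_is_sup :: "comp set \<Rightarrow> comp \<Rightarrow> bool" where
  "comp_is_sup A \<sigma> \<longleftrightarrow>
     compactification \<sigma> \<and> (\<forall>\<alpha>\<in>A. comp_le \<alpha> \<sigma>) \<and>
     (\<forall>\<tau> :: comp. compactification \<tau> \<and> (\<forall>\<alpha>\<in>A. comp_le \<alpha> \<tau>) \<longrightarrow> comp_le \<sigma> \<tau>)"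

definition comp_sup :: "comp set \<Rightarrow> comp" where
  "comp_sup A = (SOME \<sigma>. comp_is_sup A \<sigma>)"


section \<open>Proper metrics and Higson compactifications\<close>

definition PM :: "(nat \<Rightarrow> nat \<Rightarrow> real) set" where
  "PM = {d. Metric_space UNIV d \<and>
            Metric_space.mtopology UNIV d = discrete_topology UNIV \<and>
            (\<forall>A. Metric_space.mbounded UNIV d A \<longrightarrow>
                 compactin (Metric_space.mtopology UNIV d)
                   (Metric_space.mtopology UNIV d closure_of A))}"

text \<open>
  For \<open>d \<in> PM\<close> balls are finite, so that \<^const>\<open>diameter\<close> is applied to a finite set.
\<close>

definition slowly_oscillating :: "(nat \<Rightarrow> nat \<Rightarrow> real) \<Rightarrow> (nat \<Rightarrow> real) \<Rightarrow> bool" where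
  "slowly_oscillating d f \<longleftrightarrow>
     (\<forall>r>0. \<forall>\<epsilon>>0. \<exists>K. finite K \<and>
        (\<forall>x. x \<notin> K \<longrightarrow> diameter (f ` Metric_space.mball UNIV d x r) < \<epsilon>))"

definition higson_functions :: "(nat \<Rightarrow> nat \<Rightarrow> real) \<Rightarrow> (nat \<Rightarrow> real) set" where
  "higson_functions d = {f. bounded (range f) \<and> slowly_oscillating d f}"

definition higson :: "(nat \<Rightarrow> nat \<Rightarrow> real) \<Rightarrow> comp" where
  "higson d = (SOME \<alpha>. compactification \<alpha> \<and> ext_functions \<alpha> = higson_functions d)"

definition PM' :: "(nat \<Rightarrow> nat \<Rightarrow> real) set" where
  "PM' = {d \<in> PM. \<not> comp_equiv stone_cech (higson d)}"

definition higson_le :: "(nat \<Rightarrow> nat \<Rightarrow> real) \<Rightarrow> (nat \<Rightarrow> nat \<Rightarrow> real) \<Rightarrow> bool" (infix "\<sqsubseteq>\<^sub>H" 50) where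
  "d\<^sub>1 \<sqsubseteq>\<^sub>H d\<^sub>2 \<longleftrightarrow> higson_functions d\<^sub>1 \<subseteq> higson_functions d\<^sub>2"

definition higson_directed :: "(nat \<Rightarrow> nat \<Rightarrow> real) set \<Rightarrow> bool" where
  "higson_directed D \<longleftrightarrow> (\<forall>d\<^sub>1\<in>D. \<forall>d\<^sub>2\<in>D. \<exists>d\<in>D. d\<^sub>1 \<sqsubseteq>\<^sub>H d \<and> d\<^sub>2 \<sqsubseteq>\<^sub>H d)"


section \<open>The cardinal invariants\<close>

text \<open>
  Cardinals are represented by cardinal orders (\<^const>\<open>Card_order\<close>), compared by \<open>\<le>o\<close>.
  In \<^term>\<open>least_cardinal P\<close> the cardinals range over those of subsets of \<^typ>\<open>'a\<close>; below,
  \<^typ>\<open>'a\<close> is the type of the elements of the sets whose size is measured, so these are all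
  the sizes that can occur.
\<close>

datatype 'a xcardinal = Cardinal "'a rel" | Infinity

fun xcardinal_le :: "'a xcardinal \<Rightarrow> 'b xcardinal \<Rightarrow> bool" (infix "\<le>\<^sub>x" 50) where
  "_ \<le>\<^sub>x Infinity \<longleftrightarrow> True"
| "Infinity \<le>\<^sub>x Cardinal _ \<longleftrightarrow> False"
| "Cardinal r \<le>\<^sub>x Cardinal s \<longleftrightarrow> r \<le>o s"

definition least_cardinal :: "('a rel \<Rightarrow> bool) \<Rightarrow> 'a xcardinal" where
  "least_cardinal P =
     (if \<exists>r. Card_order r \<and> P r
      then Cardinal (SOME r. Card_order r \<and> P r \<and> (\<forall>s. Card_order s \<and> P s \<longrightarrow> r \<le>o s))
      else Infinity)"

definition hp' :: "(nat \<Rightarrow> nat \<Rightarrow> real) xcardinal" where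
  "hp' = least_cardinal (\<lambda>\<kappa>. \<exists>D. D \<subseteq> PM' \<and> higson_directed D \<and>
            comp_equiv stone_cech (comp_sup (higson ` D)) \<and> |D| =o \<kappa>)"

definition slaloms :: "(nat \<Rightarrow> nat set) set" where
  "slaloms = {\<phi>. \<forall>n. finite (\<phi> n) \<and> card (\<phi> n) \<le> n + 1}"

definition localization_number :: "(nat \<Rightarrow> nat set) xcardinal" where
  "localization_number = least_cardinal (\<lambda>\<kappa>. \<forall>h :: nat \<Rightarrow> nat.
      \<exists>\<Phi>. \<Phi> \<subseteq> slaloms \<and> |\<Phi>| =o \<kappa> \<and>
        (\<forall>f. (\<forall>n. f n < h n) \<longrightarrow> (\<exists>\<phi>\<in>\<Phi>. \<forall>\<^sub>F n in sequentially. f n \<in> \<phi> n)))"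

end

theory Submission
  imports Defs "HOL-Algebra.Free_Abelian_Groups"
begin

text \<open>
  Split \<open>\<omega>\<close> into finite blocks, the \<open>n\<close>-th having more than \<open>2 ^ (n + 1)\<^sup>2\<close> elements, and read the
  values of slaloms as codes of subsets of the blocks.  A finite set \<open>F\<close> of slaloms then gives an
  equivalence relation on \<open>\<omega>\<close>: two points of the \<open>n\<close>-th block are equivalent if no member of any
  \<open>\<phi> n\<close> with \<open>\<phi> \<in> F\<close> separates them.  Let \<open>d F\<close> be the proper metric in which equivalent points are at distance
  1, while the other distances tend to infinity with the block; a bounded \<open>f\<close> is slowly oscillating
  for \<open>d F\<close> iff its oscillation on the classes tends to 0.  By the pigeonhole principle
  infinitely many classes are nontrivial, so the Higson compactification of \<open>d F\<close> is not \<open>\<beta>\<omega>\<close>; and \<open>d F\<close>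
  increases with \<open>F\<close>.  If \<open>\<Phi>\<close> localizes the codes of the traces of every \<open>X \<subseteq> \<omega>\<close> on the blocks, then every indicator
  function is slowly oscillating for some \<open>d {\<phi>}\<close> with \<open>\<phi> \<in> \<Phi>\<close>, so that the supremum over the finite \<open>F \<subseteq> \<Phi>\<close> is \<open>\<beta>\<omega>\<close>.
  Finally, \<open>\<Phi>\<close> is infinite, so it has only \<open>|\<Phi>|\<close> finite subsets.
\<close>

section \<open>Compactifications and their rings of functions\<close>

lemma ext_functions_mono:
  assumes "comp_le \<alpha> \<gamma>"
  shows "ext_functions \<alpha> \<subseteq> ext_functions \<gamma>"
proof
  fix f assume "f \<in> ext_functions \<alpha>"
  then obtain g where b: "bounded (range f)" and g: "continuous_map (fst \<alpha>) euclideanreal g"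
    and gf: "\<And>n. g (snd \<alpha> n) = f n"
    unfolding ext_functions_def by blast
  obtain h where h: "continuous_map (fst \<gamma>) (fst \<alpha>) h" "\<And>n. h (snd \<gamma> n) = snd \<alpha> n"
    using assms unfolding comp_le_def by blast
  have "continuous_map (fst \<gamma>) euclideanreal (g \<circ> h)"
    using h(1) g by (rule continuous_map_compose)
  moreover have "(g \<circ> h) (snd \<gamma> n) = f n" for n
    by (simp add: h gf)
  ultimately show "f \<in> ext_functions \<gamma>"
    using b unfolding ext_functions_def by blast
qed

lemma compactification_in_topspace:
  assumes "compactification \<alpha>"
  shows "snd \<alpha> n \<in> topspace (fst \<alpha>)"
proof -
  have "embedding_map (discrete_topology UNIV) (fst \<alpha>) (snd \<alpha>)"
    using assms by (simp add: compactification_def)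
  then have "homeomorphic_map (discrete_topology UNIV)
      (subtopology (fst \<alpha>) (range (snd \<alpha>))) (snd \<alpha>)"
    by (simp add: embedding_map_def)
  from homeomorphic_imp_surjective_map[OF this] show ?thesis
    by auto
qed

lemma comp_le_trans:
  assumes "comp_le \<alpha> \<beta>" "comp_le \<beta> \<gamma>"
  shows "comp_le \<alpha> \<gamma>"
proof -
  obtain f g where f: "continuous_map (fst \<beta>) (fst \<alpha>) f"
      "f ` topspace (fst \<beta>) = topspace (fst \<alpha>)" "\<And>n. f (snd \<beta> n) = snd \<alpha> n"
    and g: "continuous_map (fst \<gamma>) (fst \<beta>) g"
      "g ` topspace (fst \<gamma>) = topspace (fst \<beta>)" "\<And>n. g (snd \<gamma> n) = snd \<beta> n"
    using assms unfolding comp_le_def by metis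
  have "continuous_map (fst \<gamma>) (fst \<alpha>) (f \<circ> g)"
    using g(1) f(1) by (rule continuous_map_compose)
  moreover have "(f \<circ> g) ` topspace (fst \<gamma>) = topspace (fst \<alpha>)"
    by (simp only: image_comp[symmetric] f g)
  ultimately show ?thesis
    unfolding comp_le_def using f(3) g(3) by (metis comp_apply)
qed

lemma comp_equiv_imp_le:
  assumes "comp_equiv \<alpha> \<gamma>"
  shows "comp_le \<alpha> \<gamma>"
  using assms unfolding comp_equiv_def comp_le_def
  by (metis homeomorphic_imp_continuous_map homeomorphic_imp_surjective_map)

lemma comp_equiv_sym:
  assumes "comp_equiv \<alpha> \<gamma>" "compactification \<gamma>"
  shows "comp_equiv \<gamma> \<alpha>"
proof -
  obtain f where f: "homeomorphic_map (fst \<gamma>) (fst \<alpha>) f" "\<And>n. f (snd \<gamma> n) = snd \<alpha> n"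
    using assms unfolding comp_equiv_def by blast
  obtain g where fg: "homeomorphic_maps (fst \<gamma>) (fst \<alpha>) f g"
    using f homeomorphic_map_maps by blast
  then have "g (snd \<alpha> n) = snd \<gamma> n" for n
    using f(2) compactification_in_topspace[OF assms(2)] unfolding homeomorphic_maps_def by metis
  moreover have "homeomorphic_map (fst \<alpha>) (fst \<gamma>) g"
    using fg homeomorphic_maps_map by blast
  ultimately show ?thesis
    unfolding comp_equiv_def by blast
qed

lemma comp_equiv_ext_functions:
  assumes "comp_equiv \<alpha> \<gamma>" "compactification \<gamma>"
  shows "ext_functions \<alpha> = ext_functions \<gamma>"
  using assms by (simp add: comp_equiv_imp_le comp_equiv_sym ext_functions_mono subset_antisym)

lemma compactification_copy_ext:
  assumes "compactification \<alpha>"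
  obtains \<gamma> :: comp where "compactification \<gamma>" "ext_functions \<gamma> = ext_functions \<alpha>"
  using compactification_copy[OF assms] comp_equiv_ext_functions[OF _ assms] by blast

section \<open>Compactifications as closures of a diagonal in a product\<close>

definition diagonal_extension :: "'i set \<Rightarrow> ('i \<Rightarrow> 'a extension) \<Rightarrow> ('i \<Rightarrow> 'a) extension" where
  "diagonal_extension I \<xi> =
     (let P = product_topology (\<lambda>i. fst (\<xi> i)) I; e = (\<lambda>n. \<lambda>i\<in>I. snd (\<xi> i) n)
      in (subtopology P (P closure_of range e), e))"

lemma continuous_map_diagonal_extension:
  assumes "i \<in> I"
  shows "continuous_map (fst (diagonal_extension I \<xi>)) (fst (\<xi> i)) (\<lambda>x. x i)"
  unfolding diagonal_extension_def Let_def fst_conv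
  by (intro continuous_map_from_subtopology continuous_map_product_projection[OF assms])

lemma diagonal_extension_apply [simp]:
  "i \<in> I \<Longrightarrow> snd (diagonal_extension I \<xi>) n i = snd (\<xi> i) n"
  by (simp add: diagonal_extension_def Let_def)

lemma diagonal_extension_eqI:
  assumes "x \<in> topspace (fst (diagonal_extension I \<xi>))" "y \<in> topspace (fst (diagonal_extension I \<xi>))"
    and "\<And>i. i \<in> I \<Longrightarrow> x i = y i"
  shows "x = y"
proof (rule PiE_ext)
  show "x \<in> (\<Pi>\<^sub>E i\<in>I. topspace (fst (\<xi> i)))" "y \<in> (\<Pi>\<^sub>E i\<in>I. topspace (fst (\<xi> i)))"
    using assms(1,2) by (auto simp: diagonal_extension_def Let_def)
qed (use assms in auto)

text \<open>Compactness is Tychonoff's theorem. For the embedding, \<open>iso\<close> gives each n a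
  coordinate with an open set whose trace on \<omega> is {n}; its preimage isolates the image of n,
  so \<open>e\<close> is injective with discrete range.\<close>

lemma compactification_diagonal_extension:
  assumes cpt: "\<And>i. i \<in> I \<Longrightarrow> compact_space (fst (\<xi> i))"
    and H: "\<And>i. i \<in> I \<Longrightarrow> Hausdorff_space (fst (\<xi> i))"
    and top: "\<And>i n. i \<in> I \<Longrightarrow> snd (\<xi> i) n \<in> topspace (fst (\<xi> i))"
    and iso: "\<And>n. \<exists>i\<in>I. \<exists>U. openin (fst (\<xi> i)) U \<and> snd (\<xi> i) -` U = {n}"
  shows "compactification (diagonal_extension I \<xi>)"
proof -
  define P where "P = product_topology (\<lambda>i. fst (\<xi> i)) I"
  define e where "e = (\<lambda>n. \<lambda>i\<in>I. snd (\<xi> i) n)"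
  define X where "X = subtopology P (P closure_of range e)"
  have eq: "diagonal_extension I \<xi> = (X, e)"
    by (simp add: diagonal_extension_def Let_def P_def e_def X_def)
  have eP: "range e \<subseteq> topspace P"
    using top by (auto simp: P_def e_def)
  have eX: "range e \<subseteq> topspace X"
    using closure_of_subset[OF eP] eP by (auto simp: X_def)
  have "compact_space P"
    unfolding P_def compact_space_product_topology using cpt by blast
  then have "compact_space X"
    unfolding X_def by (intro compact_space_subtopology closedin_compact_space closedin_closure_of)
  moreover have "Hausdorff_space X"
    unfolding X_def P_def
    by (intro Hausdorff_space_subtopology) (simp add: Hausdorff_space_product_topology H)
  moreover have "X closure_of range e = topspace X"
  proof -
    have "X closure_of range e = P closure_of range e \<inter> P closure_of range e"
      unfolding X_def using closure_of_subtopology_subset closure_of_subset[OF eP]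
      by (metis closure_of_subtopology inf.absorb_iff2)
    then show ?thesis
      by (simp add: X_def closure_of_subset_topspace inf_absorb2)
  qed
  moreover have "embedding_map (discrete_topology UNIV) X e"
  proof -
    have isol: "\<exists>W. openin X W \<and> e -` W = {n}" for n
    proof -
      obtain i U where i: "i \<in> I" and U: "openin (fst (\<xi> i)) U" "snd (\<xi> i) -` U = {n}"
        using iso by blast
      let ?W = "{x \<in> topspace X. x i \<in> U}"
      have "openin X ?W"
        using continuous_map_diagonal_extension[OF i, of \<xi>] U(1)
        by (simp add: eq openin_continuous_map_preimage)
      moreover have "e -` ?W = {n}"
        using U(2) eX i by (auto simp: e_def)
      ultimately show ?thesis by blast
    qed
    have inj: "inj e"
    proof (rule injI)
      fix m n assume "e m = e n"
      moreover obtain W where "e -` W = {n}" using isol by blast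
      ultimately show "m = n" by blast
    qed
    have "subtopology X (range e) = discrete_topology (range e)"
    proof -
      have "openin (subtopology X (range e)) {e n}" for n
      proof -
        obtain W where "openin X W" "e -` W = {n}" using isol by blast
        moreover from this have "{e n} = W \<inter> range e" by auto
        ultimately show ?thesis unfolding openin_subtopology by blast
      qed
      moreover have "topspace (subtopology X (range e)) = range e"
        using eX by auto
      ultimately show ?thesis
        by (smt (verit, best) discrete_topology_unique image_iff)
    qed
    moreover have "homeomorphic_map (discrete_topology UNIV) (discrete_topology (range e)) e"
      using inj by (intro bijective_open_imp_homeomorphic_map) (auto simp: open_map_def)
    ultimately show ?thesis
      by (simp add: embedding_map_def)
  qed
  ultimately show ?thesis
    by (simp add: eq compactification_def)
qed

text \<open>The factor at f is the closure of the range of f, which is compact for bounded f, and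
  evaluation at f is then a continuous extension of f. This serves both the ring of all bounded
  functions and the Higson rings.\<close>

definition function_extension :: "(nat \<Rightarrow> real) set \<Rightarrow> ((nat \<Rightarrow> real) \<Rightarrow> real) extension" where
  "function_extension R =
     diagonal_extension R (\<lambda>f. (subtopology euclideanreal (closure (range f)), f))"

lemma compactification_function_extension:
  assumes bdd: "\<And>f. f \<in> R \<Longrightarrow> bounded (range f)" and ind: "\<And>n. indicat_real {n} \<in> R"
  shows "compactification (function_extension R)"
  unfolding function_extension_def
proof (rule compactification_diagonal_extension)
  fix f assume "f \<in> R"
  then have "compact (closure (range f))"
    using bdd by (simp add: compact_closure)
  then show "compact_space (fst (subtopology euclideanreal (closure (range f)), f))"
    by (simp add: compact_space_subtopology)
next
  fix n :: nat
  let ?f = "indicat_real {n}"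
  let ?S = "subtopology euclideanreal (closure (range ?f))"
  have "openin ?S (closure (range ?f) \<inter> {0<..})"
    by (simp add: openin_open_Int)
  moreover have "?f -` (closure (range ?f) \<inter> {0<..}) = {n}"
  proof -
    have "?f m \<in> closure (range ?f)" for m
      by (rule subsetD[OF closure_subset rangeI])
    then have "?f -` (closure (range ?f) \<inter> {0<..}) = {m. 0 < ?f m}"
      by blast
    also have "\<dots> = {n}"
      by (auto simp: indicator_def)
    finally show ?thesis .
  qed
  ultimately show "\<exists>f\<in>R. \<exists>U. openin (fst (subtopology euclideanreal (closure (range f)), f)) U \<and>
      snd (subtopology euclideanreal (closure (range f)), f) -` U = {n}"
    using ind by (intro bexI[of _ ?f]) auto
qed (auto intro!: Hausdorff_space_subtopology subsetD[OF closure_subset])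

lemma function_extension_coordinate:
  assumes "f \<in> R"
  shows "continuous_map (fst (function_extension R)) euclideanreal (\<lambda>x. x f)"
  using continuous_map_diagonal_extension[OF assms,
      of "\<lambda>f. (subtopology euclideanreal (closure (range f)), f)"]
  by (simp add: function_extension_def continuous_map_in_subtopology)

lemma subset_ext_functions_function_extension:
  assumes "\<And>f. f \<in> R \<Longrightarrow> bounded (range f)"
  shows "R \<subseteq> ext_functions (function_extension R)"
proof
  fix f assume f: "f \<in> R"
  then have "\<forall>n. snd (function_extension R) n f = f n"
    by (simp add: function_extension_def)
  with function_extension_coordinate[OF f] f assms show "f \<in> ext_functions (function_extension R)"
    unfolding ext_functions_def by blast
qed

section \<open>The Stone-Cech compactification\<close>

lemma bounded_range_indicat_real: "bounded (range (indicat_real A))"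
  by (rule boundedI[of _ 1]) (auto simp: indicator_def)

text \<open>The diagonal in the product of all compactifications of type \<open>comp\<close> lies
  above each factor by projection. Its own carrier type is larger, so at the end it is replaced by
  an equivalent copy of type \<open>comp\<close>.\<close>

lemma stone_cech:
  "compactification stone_cech \<and> (\<forall>\<alpha> :: comp. compactification \<alpha> \<longrightarrow> comp_le \<alpha> stone_cech)"
proof -
  define \<C> :: "comp set" where "\<C> = Collect compactification"
  let ?\<pi> = "diagonal_extension \<C> (\<lambda>\<alpha>. \<alpha>)"
  \<comment> \<open>One compactification has to be exhibited: as a coordinate, it isolates the
    points of \<omega> in the product.\<close>
  have "compactification (function_extension {f. bounded (range f)})"
    by (rule compactification_function_extension) (auto simp: bounded_range_indicat_real)
  then obtain \<alpha>\<^sub>0 :: comp where \<alpha>\<^sub>0: "compactification \<alpha>\<^sub>0"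
    using compactification_copy by blast
  have "\<exists>U. openin (fst \<alpha>\<^sub>0) U \<and> snd \<alpha>\<^sub>0 -` U = {n}" for n
  proof -
    have hom: "homeomorphic_map (discrete_topology UNIV)
        (subtopology (fst \<alpha>\<^sub>0) (range (snd \<alpha>\<^sub>0))) (snd \<alpha>\<^sub>0)"
      using \<alpha>\<^sub>0 by (simp add: compactification_def embedding_map_def)
    have "openin (subtopology (fst \<alpha>\<^sub>0) (range (snd \<alpha>\<^sub>0))) (snd \<alpha>\<^sub>0 ` {n})"
      using homeomorphic_map_openness[OF hom, of "{n}"] by simp
    then obtain U where U: "openin (fst \<alpha>\<^sub>0) U" "{snd \<alpha>\<^sub>0 n} = U \<inter> range (snd \<alpha>\<^sub>0)"
      unfolding openin_subtopology by auto
    have inj: "inj (snd \<alpha>\<^sub>0)"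
      using homeomorphic_imp_injective_map[OF hom] by simp
    have "m = n" if "snd \<alpha>\<^sub>0 m \<in> U" for m
      using that U(2) by (intro injD[OF inj]) blast
    moreover have "snd \<alpha>\<^sub>0 n \<in> U"
      using U(2) by blast
    ultimately have "snd \<alpha>\<^sub>0 -` U = {n}"
      by blast
    with U(1) show ?thesis by blast
  qed
  then have iso: "\<exists>\<alpha>\<in>\<C>. \<exists>U. openin (fst \<alpha>) U \<and> snd \<alpha> -` U = {n}" for n
    using \<alpha>\<^sub>0 unfolding \<C>_def by (intro bexI[of _ \<alpha>\<^sub>0]) (blast, simp)
  have comp: "compactification ?\<pi>"
  proof (rule compactification_diagonal_extension)
    fix \<alpha> n assume "\<alpha> \<in> \<C>"
    then have \<alpha>: "compactification \<alpha>"
      by (simp add: \<C>_def)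
    then show "compact_space (fst \<alpha>)" "Hausdorff_space (fst \<alpha>)"
      by (simp_all add: compactification_def)
    from \<alpha> show "snd \<alpha> n \<in> topspace (fst \<alpha>)"
      by (rule compactification_in_topspace)
  qed (rule iso)
  have le: "comp_le \<alpha> ?\<pi>" if \<alpha>: "compactification \<alpha>" for \<alpha> :: comp
  proof -
    let ?p = "\<lambda>x :: comp \<Rightarrow> nat set set. x \<alpha>"
    have p: "continuous_map (fst ?\<pi>) (fst \<alpha>) ?p"
      using continuous_map_diagonal_extension[of \<alpha> \<C> "\<lambda>\<alpha>. \<alpha>"] \<alpha> by (simp add: \<C>_def)
    have app: "?p (snd ?\<pi> n) = snd \<alpha> n" for n
      using \<alpha> by (simp add: \<C>_def)
    \<comment> \<open>The projection is onto: its image is compact, hence closed, and contains the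
      dense copy of \<omega>.\<close>
    have "compactin (fst ?\<pi>) (topspace (fst ?\<pi>))"
      using comp by (simp add: compactification_def compact_space_def)
    then have "compactin (fst \<alpha>) (?p ` topspace (fst ?\<pi>))"
      using p by (rule image_compactin)
    then have "closedin (fst \<alpha>) (?p ` topspace (fst ?\<pi>))"
      using \<alpha> by (simp add: compactification_def compactin_imp_closedin)
    moreover have "range (snd \<alpha>) \<subseteq> ?p ` topspace (fst ?\<pi>)"
    proof (rule image_subsetI)
      fix n
      show "snd \<alpha> n \<in> ?p ` topspace (fst ?\<pi>)"
        using app[of n] by (rule image_eqI[OF sym compactification_in_topspace[OF comp]])
    qed
    ultimately have "fst \<alpha> closure_of range (snd \<alpha>) \<subseteq> ?p ` topspace (fst ?\<pi>)"
      by (intro closure_of_minimal)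
    then have "topspace (fst \<alpha>) \<subseteq> ?p ` topspace (fst ?\<pi>)"
      using \<alpha> by (simp add: compactification_def)
    moreover have "?p ` topspace (fst ?\<pi>) \<subseteq> topspace (fst \<alpha>)"
      using p by (rule continuous_map_image_subset_topspace)
    ultimately show ?thesis
      unfolding comp_le_def using p app by blast
  qed
  obtain \<beta> :: comp where \<beta>: "compactification \<beta>" "comp_equiv \<beta> ?\<pi>"
    using compactification_copy[OF comp] by blast
  have "comp_le \<alpha> \<beta>" if \<alpha>: "compactification \<alpha>" for \<alpha> :: comp
  proof -
    have "comp_le ?\<pi> \<beta>"
      by (rule comp_equiv_imp_le[OF comp_equiv_sym[OF \<beta>(2) comp]])
    with le[OF \<alpha>] show ?thesis
      by (rule comp_le_trans)
  qed
  with \<beta>(1) have "compactification \<beta> \<and> (\<forall>\<alpha> :: comp. compactification \<alpha> \<longrightarrow> comp_le \<alpha> \<beta>)"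
    by blast
  then show ?thesis
    unfolding stone_cech_def by (rule someI)
qed

text \<open>Every bounded f extends over the compactification generated by all bounded functions. A
  copy of that one lies below \<open>stone_cech\<close>, and going up in the order only enlarges the
  ring.\<close>

lemma bounded_in_ext_functions_stone_cech:
  assumes "bounded (range f)"
  shows "f \<in> ext_functions stone_cech"
proof -
  let ?R = "{f :: nat \<Rightarrow> real. bounded (range f)}"
  have "compactification (function_extension ?R)"
    by (rule compactification_function_extension) (auto simp: bounded_range_indicat_real)
  then obtain \<gamma> :: comp where \<gamma>: "compactification \<gamma>"
    "ext_functions \<gamma> = ext_functions (function_extension ?R)"
    using compactification_copy_ext by blast
  moreover have "f \<in> ext_functions (function_extension ?R)"
    using subset_ext_functions_function_extension[of ?R] assms by blast
  ultimately show ?thesis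
    using stone_cech ext_functions_mono by blast
qed

text \<open>
  Distinct points of \<open>\<beta>\<close> have disjoint open neighbourhoods, and the indicator function of the
  trace on \<open>\<omega>\<close> of one of them separates their images.
\<close>

lemma comp_equiv_if_indicators_extend:
  assumes \<beta>: "compactification \<beta>" and \<tau>: "compactification \<tau>" and le: "comp_le \<tau> \<beta>"
    and ind: "\<And>A. indicat_real A \<in> ext_functions \<tau>"
  shows "comp_equiv \<tau> \<beta>"
proof -
  obtain f where f: "continuous_map (fst \<beta>) (fst \<tau>) f" "f ` topspace (fst \<beta>) = topspace (fst \<tau>)"
    "\<And>n. f (snd \<beta> n) = snd \<tau> n"
    using le unfolding comp_le_def by blast
  have H: "Hausdorff_space (fst \<beta>)" and dense: "fst \<beta> closure_of range (snd \<beta>) = topspace (fst \<beta>)"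
    using \<beta> by (auto simp: compactification_def)
  have "inj_on f (topspace (fst \<beta>))"
  proof (rule inj_onI, rule ccontr)
    fix p q assume pq: "p \<in> topspace (fst \<beta>)" "q \<in> topspace (fst \<beta>)" "f p = f q" "p \<noteq> q"
    then obtain U V where UV: "openin (fst \<beta>) U" "openin (fst \<beta>) V" "p \<in> U" "q \<in> V" "disjnt U V"
      using H unfolding Hausdorff_space_def by metis
    define A where "A = snd \<beta> -` U"
    obtain g where g: "continuous_map (fst \<tau>) euclideanreal g" "\<And>n. g (snd \<tau> n) = indicat_real A n"
      using ind[of A] unfolding ext_functions_def by blast
    have cont: "continuous_map (fst \<beta>) euclideanreal (g \<circ> f)"
      using f(1) g(1) by (rule continuous_map_compose)
    \<comment> \<open>As \<open>W\<close> is open, x is in the closure of the points of \<omega>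
      lying in \<open>W\<close>; the continuous \<open>g \<circ> f\<close> has the constant value c
      on these, hence also at x.\<close>
    have limit: "g (f x) = c" if x: "x \<in> topspace (fst \<beta>)" "openin (fst \<beta>) W" "x \<in> W"
      and c: "\<And>n. snd \<beta> n \<in> W \<Longrightarrow> indicat_real A n = c" for x W c
    proof -
      have "x \<in> fst \<beta> closure_of (W \<inter> range (snd \<beta>))"
        using openin_Int_closure_of_subset[OF x(2), of "range (snd \<beta>)"] x dense by auto
      then have "(g \<circ> f) x = (\<lambda>x. c) x"
        by (rule forall_in_closure_of_eq[OF _ Hausdorff_space_euclidean cont])
          (auto simp: c f(3) g(2))
      then show ?thesis by simp
    qed
    have "g (f p) = 1"
      using pq UV by (intro limit[of p U]) (auto simp: A_def)
    moreover have "g (f q) = 0"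
      using pq UV by (intro limit[of q V]) (auto simp: A_def disjnt_iff indicator_def)
    ultimately show False
      using pq by simp
  qed
  then have "homeomorphic_map (fst \<beta>) (fst \<tau>) f"
    using f \<beta> \<tau> by (intro continuous_imp_homeomorphic_map) (auto simp: compactification_def)
  then show ?thesis
    unfolding comp_equiv_def using f(3) by blast
qed

section \<open>Higson compactifications\<close>

text \<open>Comparing all points of a ball with its centre costs a factor 2 by the triangle
  inequality; starting from \<epsilon>/3 keeps the final bound strict. Boundedness of f makes every
  image of a ball bounded, so that \<open>diameter\<close> dominates distances.\<close>

lemma slowly_oscillating_iff:
  assumes "Metric_space UNIV d" and bdd: "bounded (range f)"
  shows "slowly_oscillating d f \<longleftrightarrow>
    (\<forall>r>0. \<forall>\<epsilon>>0. \<exists>K. finite K \<and> (\<forall>x y. x \<notin> K \<longrightarrow> d x y < r \<longrightarrow> \<bar>f x - f y\<bar> < \<epsilon>))"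
    (is "_ \<longleftrightarrow> ?rhs")
proof -
  interpret Metric_space UNIV d by fact
  show ?thesis
  proof
    assume L: "slowly_oscillating d f"
    show ?rhs
    proof (intro allI impI)
      fix r \<epsilon> :: real assume r: "r > 0" "\<epsilon> > 0"
      then obtain K where K: "finite K" "\<And>x. x \<notin> K \<Longrightarrow> diameter (f ` mball x r) < \<epsilon>"
        using L unfolding slowly_oscillating_def by blast
      have "\<bar>f x - f y\<bar> < \<epsilon>" if "x \<notin> K" "d x y < r" for x y
      proof -
        have "bounded (f ` mball x r)"
          using bdd by (rule bounded_subset) auto
        moreover have "f x \<in> f ` mball x r" "f y \<in> f ` mball x r"
          using that r by auto
        ultimately have "dist (f x) (f y) \<le> diameter (f ` mball x r)"
          by (rule diameter_bounded_bound)
        with K(2)[OF that(1)] show ?thesis by (simp add: dist_real_def)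
      qed
      with K(1) show "\<exists>K. finite K \<and> (\<forall>x y. x \<notin> K \<longrightarrow> d x y < r \<longrightarrow> \<bar>f x - f y\<bar> < \<epsilon>)"
        by blast
    qed
  next
    assume R: ?rhs
    show "slowly_oscillating d f"
      unfolding slowly_oscillating_def
    proof (intro allI impI)
      fix r \<epsilon> :: real assume r: "r > 0" "\<epsilon> > 0"
      then have "\<epsilon> / 3 > 0" by simp
      with R r obtain K where K: "finite K" "\<And>x y. x \<notin> K \<Longrightarrow> d x y < r \<Longrightarrow> \<bar>f x - f y\<bar> < \<epsilon> / 3"
        by metis
      have "diameter (f ` mball x r) < \<epsilon>" if x: "x \<notin> K" for x
      proof -
        have "diameter (f ` mball x r) \<le> 2 * \<epsilon> / 3"
        proof (rule diameter_le)
          fix u v assume "u \<in> f ` mball x r" "v \<in> f ` mball x r"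
          then obtain y z where yz: "u = f y" "v = f z" "d x y < r" "d x z < r"
            by auto
          show "norm (u - v) \<le> 2 * \<epsilon> / 3"
            using K(2)[OF x yz(3)] K(2)[OF x yz(4)] unfolding yz real_norm_def by linarith
        qed (use r in simp)
        with r show ?thesis by simp
      qed
      with K(1) show "\<exists>K. finite K \<and> (\<forall>x. x \<notin> K \<longrightarrow> diameter (f ` mball x r) < \<epsilon>)"
        by blast
    qed
  qed
qed

text \<open>Closed balls about n are finite by properness, and a point outside the one of radius r
  is at distance less than r only from points other than n. These indicators isolate the points of
  \<omega> in the Higson compactification.\<close>

lemma indicat_singleton_in_higson_functions:
  assumes "d \<in> PM"
  shows "indicat_real {n} \<in> higson_functions d"
proof -
  interpret Metric_space UNIV d using assms by (simp add: PM_def)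
  have disc: "mtopology = discrete_topology UNIV"
    using assms by (simp add: PM_def)
  have fin: "finite (mcball n r)" for r
  proof -
    have "compactin mtopology (mtopology closure_of mcball n r)"
      using assms mbounded_mcball unfolding PM_def by blast
    then show ?thesis
      by (simp add: disc discrete_topology_closure_of compactin_discrete_topology)
  qed
  have "slowly_oscillating d (indicat_real {n})"
    unfolding slowly_oscillating_iff[OF Metric_space_axioms bounded_range_indicat_real]
  proof (intro allI impI)
    fix r \<epsilon> :: real assume r: "r > 0" "\<epsilon> > 0"
    have "\<bar>indicat_real {n} x - indicat_real {n} y\<bar> < \<epsilon>"
      if xy: "x \<notin> mcball n r" "d x y < r" for x y
    proof -
      have "x \<noteq> n"
        using xy r by (metis in_mcball UNIV_I less_imp_le mdist_zero)
      moreover have "y \<noteq> n"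
        using xy by (metis in_mcball UNIV_I commute less_imp_le)
      ultimately show ?thesis
        using r by simp
    qed
    with fin[of r] show "\<exists>K. finite K \<and>
        (\<forall>x y. x \<notin> K \<longrightarrow> d x y < r \<longrightarrow> \<bar>indicat_real {n} x - indicat_real {n} y\<bar> < \<epsilon>)"
      by blast
  qed
  then show ?thesis
    by (simp add: higson_functions_def bounded_range_indicat_real)
qed

text \<open>
  If a continuous \<open>g\<close> were not slowly oscillating on \<open>\<omega>\<close>, then by compactness the pairs
  \<open>(x, y)\<close> witnessing this would accumulate at a pair \<open>(p, q)\<close> with \<open>g p \<noteq> g q\<close>.  But all
  coordinates of \<open>p\<close> and \<open>q\<close> agree, since the coordinate functions do oscillate slowly.
\<close>

lemma ext_functions_function_extension_higson:
  assumes d: "d \<in> PM"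
  shows "ext_functions (function_extension (higson_functions d)) = higson_functions d"
    (is "ext_functions ?\<xi> = ?R")
proof
  have R: "\<And>f. f \<in> ?R \<Longrightarrow> bounded (range f)"
    by (simp add: higson_functions_def)
  then show "?R \<subseteq> ext_functions ?\<xi>"
    by (rule subset_ext_functions_function_extension)
  define X where "X = fst ?\<xi>"
  define e where "e = snd ?\<xi>"
  have comp: "compactification ?\<xi>"
    using R indicat_singleton_in_higson_functions[OF d] by (rule compactification_function_extension)
  then have X: "compact_space X"
    by (simp add: compactification_def X_def)
  have eX: "\<And>n. e n \<in> topspace X"
    unfolding X_def e_def by (rule compactification_in_topspace[OF comp])
  have metric: "Metric_space UNIV d"
    using d by (simp add: PM_def)
  have osc: "\<exists>K. finite K \<and> (\<forall>x y. x \<notin> K \<longrightarrow> d x y < r \<longrightarrow> \<bar>f x - f y\<bar> < \<delta>)"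
    if "f \<in> ?R" "r > 0" "\<delta> > 0" for f r \<delta>
    using that slowly_oscillating_iff[OF metric] R unfolding higson_functions_def by blast
  show "ext_functions ?\<xi> \<subseteq> ?R"
  proof
    fix f assume f: "f \<in> ext_functions ?\<xi>"
    then obtain g where g: "continuous_map X euclideanreal g" and ge: "\<And>n. g (e n) = f n"
      unfolding ext_functions_def X_def e_def by blast
    have bf: "bounded (range f)"
      using f by (simp add: ext_functions_def)
    have "slowly_oscillating d f"
    proof (rule ccontr)
      assume "\<not> slowly_oscillating d f"
      then obtain r \<epsilon> where r: "r > 0" "\<epsilon> > 0"
        and bad: "\<And>K. finite K \<Longrightarrow> \<exists>x y. x \<notin> K \<and> d x y < r \<and> \<bar>f x - f y\<bar> \<ge> \<epsilon>"
        unfolding slowly_oscillating_iff[OF metric bf] by (meson linorder_not_less)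
      define P where "P n = {(e x, e y) |x y. x \<ge> n \<and> d x y < r \<and> \<bar>f x - f y\<bar> \<ge> \<epsilon>}" for n
      let ?X2 = "prod_topology X X"
      have P_sub: "P n \<subseteq> topspace ?X2" for n
        using eX by (auto simp: P_def)
      have P_ne: "P n \<noteq> {}" for n :: nat
      proof -
        obtain x y where "x \<notin> {..<n}" "d x y < r" "\<bar>f x - f y\<bar> \<ge> \<epsilon>"
          using bad[of "{..<n}"] by blast
        moreover from this have "x \<ge> n" by simp
        ultimately have "(e x, e y) \<in> P n"
          unfolding P_def by blast
        then show ?thesis by blast
      qed
      have P_dec: "P n \<subseteq> P m" if "m \<le> n" for m n
        unfolding P_def using order_trans[OF that] by blast
      have "(\<Inter>n. ?X2 closure_of P n) \<noteq> {}"
      proof (rule compact_space_imp_nest[of ?X2])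
        show "compact_space ?X2"
          using X by (simp add: compact_space_prod_topology)
        show "?X2 closure_of P n \<noteq> {}" for n
          using P_ne[of n] closure_of_subset[OF P_sub[of n]] by blast
        show "decseq (\<lambda>n. ?X2 closure_of P n)"
          unfolding decseq_def by (intro allI impI closure_of_mono P_dec)
      qed simp
      then obtain p q where pq: "\<And>n. (p, q) \<in> ?X2 closure_of P n"
        by auto
      have diff_cont: "continuous_map ?X2 euclideanreal (\<lambda>z. \<bar>k (fst z) - k (snd z)\<bar>)"
        if "continuous_map X euclideanreal k" for k
        using continuous_map_compose[OF continuous_map_fst that, of X]
          continuous_map_compose[OF continuous_map_snd that, of X]
        by (intro continuous_map_real_abs continuous_map_diff) (simp_all add: o_def)
      \<comment> \<open>A closed condition on the increments of k along \<open>P n\<close> passes to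
        the accumulation pair. It is applied to g with a lower bound and to the coordinates with
        upper bounds.\<close>
      have transfer: "\<bar>k p - k q\<bar> \<in> C"
        if k: "continuous_map X euclideanreal k" and C: "closed C"
          and P: "\<And>x y. x \<ge> n \<Longrightarrow> d x y < r \<Longrightarrow> \<bar>f x - f y\<bar> \<ge> \<epsilon> \<Longrightarrow> \<bar>k (e x) - k (e y)\<bar> \<in> C"
        for k C n
      proof -
        let ?T = "{z \<in> topspace ?X2. \<bar>k (fst z) - k (snd z)\<bar> \<in> C}"
        have "closedin ?X2 ?T"
          using closedin_continuous_map_preimage[OF diff_cont[OF k], of C] C by simp
        moreover have "P n \<subseteq> ?T"
          using P P_sub[of n] unfolding P_def by fastforce
        ultimately have "(p, q) \<in> ?T"
          using closure_of_minimal pq by blast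
        then show ?thesis by simp
      qed
      have "\<bar>g p - g q\<bar> \<in> {\<epsilon>..}"
        by (rule transfer[OF g]) (auto simp: ge)
      moreover have "p k = q k" if k: "k \<in> ?R" for k
      proof (rule ccontr)
        assume "p k \<noteq> q k"
        \<comment> \<open>Half the difference: passing to the closure only leaves the weak
          inequality with \<delta>, which must still be contradictory.\<close>
        define \<delta> where "\<delta> = \<bar>p k - q k\<bar> / 2"
        have "\<delta> > 0"
          using \<open>p k \<noteq> q k\<close> by (simp add: \<delta>_def)
        then obtain K where K: "finite K" "\<And>x y. x \<notin> K \<Longrightarrow> d x y < r \<Longrightarrow> \<bar>k x - k y\<bar> < \<delta>"
          using osc[OF k r(1)] by blast
        obtain n where n: "K \<subseteq> {..<n}"
          using K(1) finite_nat_iff_bounded by blast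
        have "\<bar>p k - q k\<bar> \<in> {..\<delta>}"
        proof (rule transfer[of "\<lambda>z. z k"])
          show "continuous_map X euclideanreal (\<lambda>z. z k)"
            unfolding X_def by (rule function_extension_coordinate[OF k])
          fix x y assume "x \<ge> n" "d x y < r"
          then have "\<bar>k x - k y\<bar> < \<delta>"
            using n by (intro K(2)) auto
          then show "\<bar>e x k - e y k\<bar> \<in> {..\<delta>}"
            using k by (simp add: e_def function_extension_def)
        qed simp
        with \<open>\<delta> > 0\<close> show False
          by (simp add: \<delta>_def)
      qed
      moreover have "p \<in> topspace X" "q \<in> topspace X"
        using pq[of 0] closure_of_subset_topspace[of ?X2 "P 0"] by auto
      ultimately have "p = q"
        unfolding X_def function_extension_def by (intro diagonal_extension_eqI) auto
      with \<open>\<bar>g p - g q\<bar> \<in> {\<epsilon>..}\<close> r(2) show False by simp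
    qed
    with bf show "f \<in> ?R"
      by (simp add: higson_functions_def)
  qed
qed

lemma higson:
  assumes d: "d \<in> PM"
  shows "compactification (higson d)" "ext_functions (higson d) = higson_functions d"
proof -
  have "compactification (function_extension (higson_functions d))"
    using indicat_singleton_in_higson_functions[OF d]
    by (intro compactification_function_extension) (auto simp: higson_functions_def)
  then obtain \<alpha> :: comp where "compactification \<alpha> \<and> ext_functions \<alpha> = higson_functions d"
    using compactification_copy_ext ext_functions_function_extension_higson[OF d] by metis
  then have "compactification (higson d) \<and> ext_functions (higson d) = higson_functions d"
    unfolding higson_def by (rule someI)
  then show "compactification (higson d)" "ext_functions (higson d) = higson_functions d"
    by auto
qed

text \<open>Such an f extends over \<beta>\<omega> but not over the Higson compactification, and
  equivalent compactifications have the same ring.\<close>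

lemma PM'_I:
  assumes "d \<in> PM" "bounded (range f)" "\<not> slowly_oscillating d f"
  shows "d \<in> PM'"
proof -
  have "\<not> comp_equiv stone_cech (higson d)"
  proof
    assume "comp_equiv stone_cech (higson d)"
    then have "ext_functions stone_cech = higson_functions d"
      using higson[OF assms(1)] by (simp add: comp_equiv_ext_functions)
    then show False
      using bounded_in_ext_functions_stone_cech[OF assms(2)] assms(3) by (simp add: higson_functions_def)
  qed
  with assms(1) show ?thesis by (simp add: PM'_def)
qed

text \<open>Indicators extend over every upper bound of the Higson compactifications, so every upper
  bound is equivalent to \<beta>\<omega>. This is used twice: to see that \<beta>\<omega> is a
  supremum, and for the supremum picked by \<open>comp_sup\<close>.\<close>

lemma comp_equiv_stone_cech_comp_sup:
  assumes D: "D \<subseteq> PM" and ind: "\<And>A. \<exists>d\<in>D. indicat_real A \<in> higson_functions d"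
  shows "comp_equiv stone_cech (comp_sup (higson ` D))"
proof -
  have upper: "comp_equiv \<tau> stone_cech"
    if \<tau>: "compactification \<tau>" and le: "\<forall>\<alpha>\<in>higson ` D. comp_le \<alpha> \<tau>" for \<tau> :: comp
  proof (rule comp_equiv_if_indicators_extend)
    fix A
    obtain d where "d \<in> D" "indicat_real A \<in> higson_functions d"
      using ind by blast
    then show "indicat_real A \<in> ext_functions \<tau>"
      using higson(2) D le ext_functions_mono by (metis image_eqI subsetD)
    show "comp_le \<tau> stone_cech"
      using \<tau> stone_cech by blast
  qed (use \<tau> stone_cech in blast)+
  have "comp_is_sup (higson ` D) stone_cech"
    unfolding comp_is_sup_def
  proof (intro conjI ballI allI impI)
    show "compactification stone_cech"
      using stone_cech by blast
    show "comp_le \<alpha> stone_cech" if "\<alpha> \<in> higson ` D" for \<alpha>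
      using that D higson(1) stone_cech by blast
    fix \<tau> :: comp assume \<tau>: "compactification \<tau> \<and> (\<forall>\<alpha>\<in>higson ` D. comp_le \<alpha> \<tau>)"
    show "comp_le stone_cech \<tau>"
      by (rule comp_equiv_imp_le[OF comp_equiv_sym])
        (rule upper[OF conjunct1[OF \<tau>] conjunct2[OF \<tau>]], rule conjunct1[OF stone_cech])
  qed
  then have "comp_is_sup (higson ` D) (comp_sup (higson ` D))"
    unfolding comp_sup_def by (rule someI)
  then have "comp_equiv (comp_sup (higson ` D)) stone_cech"
    unfolding comp_is_sup_def by (intro upper) blast+
  then show ?thesis
    by (rule comp_equiv_sym[OF _ conjunct1[OF stone_cech]])
qed

section \<open>Metrics from slaloms\<close>

text \<open>The disjoint union of the sets {..c n} is countably infinite; b is the first coordinate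
  of an enumeration of it.\<close>

lemma ex_blocks:
  fixes c :: "nat \<Rightarrow> nat"
  shows "\<exists>b :: nat \<Rightarrow> nat. \<forall>n. finite (b -` {n}) \<and> card (b -` {n}) > c n"
proof -
  define S where "S = (SIGMA n:UNIV. {..c n})"
  have "infinite S"
  proof
    assume "finite S"
    then have "finite (fst ` S)" by simp
    moreover have "fst ` S = UNIV" by (force simp: S_def)
    ultimately show False by simp
  qed
  then have bij: "bij_betw (from_nat_into S) UNIV S"
    by (intro bij_betw_from_nat_into) auto
  have "finite ((fst \<circ> from_nat_into S) -` {n}) \<and> card ((fst \<circ> from_nat_into S) -` {n}) > c n" for n
  proof -
    have "bij_betw (from_nat_into S) ((fst \<circ> from_nat_into S) -` {n}) ({n} \<times> {..c n})"
    proof (rule bij_betw_subset[OF bij])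
      have "from_nat_into S ` ((fst \<circ> from_nat_into S) -` {n}) = fst -` {n} \<inter> S"
        unfolding vimage_comp[symmetric] image_vimage_eq bij_betw_imp_surj_on[OF bij] ..
      also have "\<dots> = {n} \<times> {..c n}"
        by (auto simp: S_def)
      finally show "from_nat_into S ` ((fst \<circ> from_nat_into S) -` {n}) = {n} \<times> {..c n}" .
    qed simp
    then show ?thesis
      by (simp add: bij_betw_finite bij_betw_same_card)
  qed
  then show ?thesis by blast
qed

text \<open>For n at least \<open>card F\<close>, the slaloms in F have at most (n + 1)^2 values at
  n, hence split the n-th block into at most 2^((n + 1)^2) classes. Thus one partition into blocks
  serves all finite F.\<close>

locale blocks =
  fixes b :: "nat \<Rightarrow> nat"
  assumes finite_block: "finite (b -` {n})"
    and card_block: "2 ^ (n + 1)\<^sup>2 < card (b -` {n})"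
begin

text \<open>A natural number in a slalom is read as the code of a finite subset of a block.\<close>

definition equivalent :: "(nat \<Rightarrow> nat set) set \<Rightarrow> nat \<Rightarrow> nat \<Rightarrow> bool" where
  "equivalent F x y \<longleftrightarrow> b x = b y \<and>
     (\<forall>\<phi>\<in>F. \<forall>m\<in>\<phi> (b x). x \<in> set_decode m \<longleftrightarrow> y \<in> set_decode m)"

text \<open>The last value grows with the block, so balls are finite, and outside finitely many
  blocks a ball of given radius stays within a class. Taking the maximum gives symmetry and is
  compatible with the triangle inequality.\<close>

definition slalom_dist :: "(nat \<Rightarrow> nat set) set \<Rightarrow> nat \<Rightarrow> nat \<Rightarrow> real" where
  "slalom_dist F x y =
     (if x = y then 0 else if equivalent F x y then 1 else real (max (b x) (b y)) + 2)"

lemma equivalent_refl: "equivalent F x x"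
  by (simp add: equivalent_def)

lemma equivalent_sym: "equivalent F x y \<Longrightarrow> equivalent F y x"
  by (simp add: equivalent_def)

lemma equivalent_trans: "equivalent F x y \<Longrightarrow> equivalent F y z \<Longrightarrow> equivalent F x z"
  by (simp add: equivalent_def)

lemma finite_blocks_below: "finite {x. b x < k}"
proof -
  have "{x. b x < k} = (\<Union>n<k. b -` {n})" by auto
  then show ?thesis using finite_block by simp
qed

lemma Metric_space_slalom_dist: "Metric_space UNIV (slalom_dist F)"
proof
  show "slalom_dist F x y = slalom_dist F y x" for x y
    using equivalent_sym by (auto simp: slalom_dist_def)
  show "slalom_dist F x z \<le> slalom_dist F x y + slalom_dist F y z" for x y z
  proof (cases "x = y \<or> y = z \<or> x = z \<or> equivalent F x z")
    case True
    then show ?thesis by (auto simp: slalom_dist_def)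
  next
    case False
    \<comment> \<open>One of the two steps joins inequivalent points; the other, if it joins
      equivalent points, stays in its block, so the maximum is not lost.\<close>
    have "\<not> (equivalent F x y \<and> equivalent F y z)"
      using False equivalent_trans by blast
    moreover have "equivalent F x y \<Longrightarrow> b x = b y" "equivalent F y z \<Longrightarrow> b y = b z"
      by (auto simp: equivalent_def)
    ultimately show ?thesis
      using False by (auto simp: slalom_dist_def)
  qed
qed (auto simp: slalom_dist_def)

lemma slalom_dist_PM: "slalom_dist F \<in> PM"
proof -
  interpret Metric_space UNIV "slalom_dist F" by (rule Metric_space_slalom_dist)
  have "openin mtopology {x}" for x
    unfolding openin_mtopology
    by (auto simp: slalom_dist_def split: if_splits intro!: exI[of _ 1])
  then have disc: "mtopology = discrete_topology UNIV"
    by (metis discrete_topology_unique topspace_mtopology)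
  have "finite A" if A: "mbounded A" for A
  proof -
    obtain x B where x: "A \<subseteq> mcball x B"
      using A unfolding mbounded_def by blast
    have "mcball x B \<subseteq> insert x {y. b y < nat \<lceil>B\<rceil> + b x + 1}"
    proof
      fix y assume "y \<in> mcball x B"
      then have *: "slalom_dist F x y \<le> B" by simp
      show "y \<in> insert x {y. b y < nat \<lceil>B\<rceil> + b x + 1}"
      proof (cases "y = x \<or> equivalent F x y")
        case True
        then show ?thesis by (auto simp: equivalent_def)
      next
        case False
        then have "real (b y) \<le> B"
          using * by (auto simp: slalom_dist_def)
        then have "b y \<le> nat \<lceil>B\<rceil>"
          by linarith
        then show ?thesis by simp
      qed
    qed
    then show ?thesis
      using x finite_blocks_below by (meson finite_insert finite_subset)
  qed
  then show ?thesis
    unfolding PM_def using Metric_space_axioms disc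
    by (simp add: discrete_topology_closure_of compactin_discrete_topology)
qed

text \<open>Radius 2 already captures equivalence. Conversely, for any r, points at distance less
  than r from x are equivalent to x once \<open>b x\<close> is at least r, and only finitely many x
  fail this.\<close>

lemma slalom_dist_higson_functions_iff:
  "f \<in> higson_functions (slalom_dist F) \<longleftrightarrow> bounded (range f) \<and>
     (\<forall>\<epsilon>>0. \<exists>K. finite K \<and> (\<forall>x y. x \<notin> K \<longrightarrow> equivalent F x y \<longrightarrow> \<bar>f x - f y\<bar> < \<epsilon>))"
proof (cases "bounded (range f)")
  case True
  note iff = slowly_oscillating_iff[OF Metric_space_slalom_dist True, of F]
  have "slowly_oscillating (slalom_dist F) f \<longleftrightarrow>
     (\<forall>\<epsilon>>0. \<exists>K. finite K \<and> (\<forall>x y. x \<notin> K \<longrightarrow> equivalent F x y \<longrightarrow> \<bar>f x - f y\<bar> < \<epsilon>))" (is "?L \<longleftrightarrow> ?R")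
  proof
    assume L: ?L
    show ?R
    proof (intro allI impI)
      fix \<epsilon> :: real assume "\<epsilon> > 0"
      then obtain K where K: "finite K"
        "\<forall>x y. x \<notin> K \<longrightarrow> slalom_dist F x y < 2 \<longrightarrow> \<bar>f x - f y\<bar> < \<epsilon>"
        using L[unfolded iff, rule_format, of 2 \<epsilon>] by auto
      have "slalom_dist F x y < 2" if "equivalent F x y" for x y
        using that by (simp add: slalom_dist_def)
      with K show "\<exists>K. finite K \<and> (\<forall>x y. x \<notin> K \<longrightarrow> equivalent F x y \<longrightarrow> \<bar>f x - f y\<bar> < \<epsilon>)"
        by blast
    qed
  next
    assume R: ?R
    show ?L
      unfolding iff
    proof (intro allI impI)
      fix r \<epsilon> :: real assume "r > 0" "\<epsilon> > 0"
      then obtain K where K: "finite K" "\<And>x y. x \<notin> K \<Longrightarrow> equivalent F x y \<Longrightarrow> \<bar>f x - f y\<bar> < \<epsilon>"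
        using R by blast
      have "equivalent F x y" if "x \<notin> {x. b x < nat \<lceil>r\<rceil>}" "slalom_dist F x y < r" for x y
      proof (rule ccontr)
        assume "\<not> equivalent F x y"
        then have "real (b x) < r"
          using that(2) equivalent_refl by (auto simp: slalom_dist_def split: if_splits)
        moreover have "nat \<lceil>r\<rceil> \<le> b x"
          using that(1) by (simp only: mem_Collect_eq not_less)
        ultimately show False
          using of_nat_ceiling[of r] by linarith
      qed
      with K show "\<exists>K. finite K \<and> (\<forall>x y. x \<notin> K \<longrightarrow> slalom_dist F x y < r \<longrightarrow> \<bar>f x - f y\<bar> < \<epsilon>)"
        using finite_blocks_below[of "nat \<lceil>r\<rceil>"]
        by (intro exI[of _ "K \<union> {x. b x < nat \<lceil>r\<rceil>}"] conjI finite_UnI) auto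
    qed
  qed
  with True show ?thesis
    by (simp add: higson_functions_def)
qed (simp add: higson_functions_def)

text \<open>A larger set of slaloms separates more points, so fewer pairs constrain the
  oscillation.\<close>

lemma slalom_dist_higson_le:
  assumes "F \<subseteq> G"
  shows "slalom_dist F \<sqsubseteq>\<^sub>H slalom_dist G"
proof -
  have "equivalent G x y \<Longrightarrow> equivalent F x y" for x y
    using assms by (auto simp: equivalent_def)
  then show ?thesis
    unfolding higson_le_def slalom_dist_higson_functions_iff subset_iff by metis
qed

text \<open>In all late blocks the trace of X is among the sets decoded from \<phi>, so equivalent
  points there agree on membership in X and the oscillation is 0.\<close>

lemma indicat_in_higson_functions_slalom_dist:
  assumes "\<phi> \<in> F" and ev: "\<forall>\<^sub>F n in sequentially. set_encode (X \<inter> b -` {n}) \<in> \<phi> n"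
  shows "indicat_real X \<in> higson_functions (slalom_dist F)"
proof -
  obtain N where N: "\<And>n. n \<ge> N \<Longrightarrow> set_encode (X \<inter> b -` {n}) \<in> \<phi> n"
    using ev unfolding eventually_sequentially by blast
  have "x \<in> X \<longleftrightarrow> y \<in> X" if "x \<notin> {x. b x < N}" "equivalent F x y" for x y
  proof -
    let ?m = "set_encode (X \<inter> b -` {b x})"
    have "set_decode ?m = X \<inter> b -` {b x}"
      using finite_block by (intro set_encode_inverse) simp
    moreover have "x \<in> set_decode ?m \<longleftrightarrow> y \<in> set_decode ?m"
      using that N assms(1) unfolding equivalent_def by (auto simp: not_less)
    ultimately show ?thesis
      using that(2) by (auto simp: equivalent_def)
  qed
  then have "\<forall>x y. x \<notin> {x. b x < N} \<longrightarrow> equivalent F x y \<longrightarrow>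
      \<bar>indicat_real X x - indicat_real X y\<bar> < \<epsilon>" if "\<epsilon> > 0" for \<epsilon>
    using that by (simp add: indicator_def)
  with finite_blocks_below[of N] have "\<forall>\<epsilon>>0. \<exists>K. finite K \<and> (\<forall>x y. x \<notin> K \<longrightarrow> equivalent F x y \<longrightarrow>
      \<bar>indicat_real X x - indicat_real X y\<bar> < \<epsilon>)"
    by blast
  then show ?thesis
    by (simp only: slalom_dist_higson_functions_iff bounded_range_indicat_real simp_thms)
qed

text \<open>
  The pigeonhole principle: \<open>k\<close> slaloms split the \<open>n\<close>-th block into at most \<open>2 ^ (k * (n + 1))\<close>
  classes, so for \<open>n \<ge> k\<close> some class has two elements.
\<close>

lemma ex_equivalent:
  assumes F: "finite F" "F \<subseteq> slaloms" and n: "card F \<le> n"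
  shows "\<exists>x y. x \<noteq> y \<and> b x = n \<and> equivalent F x y"
proof -
  define M where "M = (\<Union>\<phi>\<in>F. \<phi> n)"
  define t where "t x = {m \<in> M. x \<in> set_decode m}" for x
  have M: "finite M" "card M \<le> (n + 1)\<^sup>2"
  proof -
    show "finite M"
      unfolding M_def using F by (auto simp: slaloms_def)
    have "card M \<le> (\<Sum>\<phi>\<in>F. card (\<phi> n))"
      unfolding M_def by (rule card_UN_le[OF F(1)])
    also have "\<dots> \<le> (\<Sum>\<phi>\<in>F. n + 1)"
      using F(2) by (intro sum_mono) (auto simp: slaloms_def)
    also have "\<dots> = card F * (n + 1)"
      by simp
    also have "\<dots> \<le> (n + 1)\<^sup>2"
      unfolding power2_eq_square using n by (intro mult_right_mono) auto
    finally show "card M \<le> (n + 1)\<^sup>2" .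
  qed
  have "\<not> inj_on t (b -` {n})"
  proof
    assume "inj_on t (b -` {n})"
    then have "card (b -` {n}) \<le> card (Pow M)"
      by (rule card_inj_on_le) (use M(1) in \<open>auto simp: t_def\<close>)
    also have "\<dots> \<le> 2 ^ (n + 1)\<^sup>2"
      using M by (simp add: card_Pow)
    finally show False
      using card_block[of n] by simp
  qed
  then obtain x y where xy: "b x = n" "b y = n" "t x = t y" "x \<noteq> y"
    unfolding inj_on_def by auto
  have "equivalent F x y"
    unfolding equivalent_def using xy by (auto simp: t_def M_def set_eq_iff)
  with xy show ?thesis by blast
qed

text \<open>Let X consist of one point from an equivalent pair in each late block. The partner lies
  outside X, since X meets each block at most once, so the oscillation is 1 on infinitely many
  classes.\<close>

lemma ex_indicat_not_in_higson_functions: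
  assumes F: "finite F" "F \<subseteq> slaloms"
  shows "\<exists>X. indicat_real X \<notin> higson_functions (slalom_dist F)"
proof -
  obtain u v where uv: "\<And>n. card F \<le> n \<Longrightarrow> u n \<noteq> v n \<and> b (u n) = n \<and> equivalent F (u n) (v n)"
    using ex_equivalent[OF F] by metis
  define X where "X = u ` {card F..}"
  have "indicat_real X \<notin> higson_functions (slalom_dist F)"
  proof
    assume "indicat_real X \<in> higson_functions (slalom_dist F)"
    moreover have "(1::real) > 0" by simp
    ultimately obtain K where K: "finite K"
      "\<And>x y. x \<notin> K \<Longrightarrow> equivalent F x y \<Longrightarrow> \<bar>indicat_real X x - indicat_real X y\<bar> < 1"
      unfolding slalom_dist_higson_functions_iff by blast
    \<comment> \<open>A block beyond all those meeting \<open>K\<close>, and late enough to contain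
      a pair.\<close>
    define n where "n = max (card F) (Suc (Max (b ` K)))"
    have n: "card F \<le> n" by (simp add: n_def)
    have "u n \<notin> K"
    proof
      assume "u n \<in> K"
      then have "b (u n) \<le> Max (b ` K)"
        using K(1) by (intro Max_ge) auto
      then show False
        using uv[OF n] by (simp add: n_def)
    qed
    moreover have "u n \<in> X"
      using n by (simp add: X_def)
    moreover have "v n \<notin> X"
    proof
      assume "v n \<in> X"
      then obtain m where m: "card F \<le> m" "v n = u m"
        by (auto simp: X_def)
      then have "m = n"
        using uv[OF n] uv[OF m(1)] by (simp add: equivalent_def)
      with m(2) uv[OF n] show False by simp
    qed
    ultimately show False
      using K(2)[of "u n" "v n"] uv[OF n] by simp
  qed
  then show ?thesis by blast
qed

lemma slalom_dist_PM':
  assumes "finite F" "F \<subseteq> slaloms"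
  shows "slalom_dist F \<in> PM'"
proof -
  obtain X where "indicat_real X \<notin> higson_functions (slalom_dist F)"
    using ex_indicat_not_in_higson_functions[OF assms] by blast
  then have "\<not> slowly_oscillating (slalom_dist F) (indicat_real X)"
    by (simp add: higson_functions_def bounded_range_indicat_real)
  with slalom_dist_PM bounded_range_indicat_real show ?thesis
    by (rule PM'_I)
qed

text \<open>This is the h to which localization is applied; \<open>Suc\<close> makes the bound on
  codes strict, as the definition of the cardinal requires.\<close>

definition code_bound :: "nat \<Rightarrow> nat" where
  "code_bound n = Suc (Max (set_encode ` Pow (b -` {n})))"

lemma set_encode_less_code_bound: "set_encode (X \<inter> b -` {n}) < code_bound n"
  unfolding code_bound_def less_Suc_eq_le
  by (rule Max_ge) (auto simp: finite_block)

lemma ex_directed_family: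
  assumes \<Phi>: "\<Phi> \<subseteq> slaloms"
    and loc: "\<And>f. (\<forall>n. f n < code_bound n) \<Longrightarrow> \<exists>\<phi>\<in>\<Phi>. \<forall>\<^sub>F n in sequentially. f n \<in> \<phi> n"
  shows "\<exists>D. D \<subseteq> PM' \<and> higson_directed D \<and>
    comp_equiv stone_cech (comp_sup (higson ` D)) \<and> |D| \<le>o |\<Phi>|"
proof -
  have loc': "\<exists>\<phi>\<in>\<Phi>. \<forall>\<^sub>F n in sequentially. set_encode (X \<inter> b -` {n}) \<in> \<phi> n" for X
    by (rule loc) (simp add: set_encode_less_code_bound)
  \<comment> \<open>A finite \<Phi> could be used as F itself: localization would make every
    indicator slowly oscillating for \<open>slalom_dist \<Phi>\<close>, contrary to the pigeonhole
    argument.\<close>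
  have "infinite \<Phi>"
  proof
    assume "finite \<Phi>"
    then obtain X where "indicat_real X \<notin> higson_functions (slalom_dist \<Phi>)"
      using ex_indicat_not_in_higson_functions \<Phi> by blast
    then show False
      using loc'[of X] indicat_in_higson_functions_slalom_dist by blast
  qed
  \<comment> \<open>Finite subsets keep the metrics in \<open>PM'\<close> and unions give
    directedness, while infinity of \<Phi> keeps their number at \<open>|\<Phi>|\<close>.\<close>
  define D where "D = slalom_dist ` Fpow \<Phi>"
  have "D \<subseteq> PM'"
    unfolding D_def Fpow_def using slalom_dist_PM' \<Phi> by blast
  moreover have "higson_directed D"
    unfolding higson_directed_def
  proof (intro ballI)
    fix d\<^sub>1 d\<^sub>2 assume "d\<^sub>1 \<in> D" "d\<^sub>2 \<in> D"
    then obtain F G where FG: "F \<in> Fpow \<Phi>" "G \<in> Fpow \<Phi>" "d\<^sub>1 = slalom_dist F" "d\<^sub>2 = slalom_dist G"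
      unfolding D_def by blast
    then have "slalom_dist (F \<union> G) \<in> D"
      unfolding D_def Fpow_def by blast
    with FG show "\<exists>d\<in>D. d\<^sub>1 \<sqsubseteq>\<^sub>H d \<and> d\<^sub>2 \<sqsubseteq>\<^sub>H d"
      using slalom_dist_higson_le by blast
  qed
  moreover have "comp_equiv stone_cech (comp_sup (higson ` D))"
  proof (rule comp_equiv_stone_cech_comp_sup)
    show "D \<subseteq> PM"
      unfolding D_def using slalom_dist_PM by blast
    fix X
    obtain \<phi> where \<phi>: "\<phi> \<in> \<Phi>" "\<forall>\<^sub>F n in sequentially. set_encode (X \<inter> b -` {n}) \<in> \<phi> n"
      using loc' by blast
    then have "indicat_real X \<in> higson_functions (slalom_dist {\<phi>})"
      by (intro indicat_in_higson_functions_slalom_dist) auto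
    moreover have "slalom_dist {\<phi>} \<in> D"
      unfolding D_def Fpow_def using \<phi>(1) by blast
    ultimately show "\<exists>d\<in>D. indicat_real X \<in> higson_functions d"
      by blast
  qed
  moreover have "|D| \<le>o |\<Phi>|"
    unfolding D_def using card_of_image card_of_Fpow_infinite[OF \<open>infinite \<Phi>\<close>]
    by (rule ordLeq_ordIso_trans)
  ultimately show ?thesis by blast
qed

end

section \<open>Least cardinals and the final comparison\<close>

lemma least_cardinal_cases:
  fixes P :: "'a rel \<Rightarrow> bool"
  obtains "least_cardinal P = Infinity" "\<And>r. Card_order r \<Longrightarrow> \<not> P r"
  | r where "least_cardinal P = Cardinal r" "Card_order r" "P r"
      "\<And>s. Card_order s \<Longrightarrow> P s \<Longrightarrow> r \<le>o s"
proof (cases "\<exists>r. Card_order r \<and> P r")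
  case True
  let ?Q = "\<lambda>r. Card_order r \<and> P r \<and> (\<forall>s. Card_order s \<and> P s \<longrightarrow> r \<le>o s)"
  \<comment> \<open>Cardinal orders are well-ordered up to \<open>=o\<close>, so the choice in
    \<open>least_cardinal\<close> is from a nonempty set.\<close>
  have "\<exists>r. ?Q r"
    using exists_minim_Card_order[of "{r. Card_order r \<and> P r}"] True by blast
  then have "?Q (SOME r. ?Q r)"
    by (rule someI_ex)
  moreover have "least_cardinal P = Cardinal (SOME r. ?Q r)"
    using True by (simp add: least_cardinal_def)
  ultimately show ?thesis
    using that(2) by blast
next
  case False
  then show ?thesis
    using that(1) by (auto simp: least_cardinal_def)
qed

theorem theorem6p11:
  shows "hp' \<le>\<^sub>x localization_number"
proof (cases rule: least_cardinal_cases[of "\<lambda>\<kappa> :: (nat \<Rightarrow> nat set) rel. \<forall>h :: nat \<Rightarrow> nat.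
      \<exists>\<Phi>. \<Phi> \<subseteq> slaloms \<and> |\<Phi>| =o \<kappa> \<and>
        (\<forall>f. (\<forall>n. f n < h n) \<longrightarrow> (\<exists>\<phi>\<in>\<Phi>. \<forall>\<^sub>F n in sequentially. f n \<in> \<phi> n))"])
  case 1
  then show ?thesis
    by (simp add: localization_number_def)
next
  case (2 \<kappa>)
  obtain b :: "nat \<Rightarrow> nat" where "\<And>n. finite (b -` {n}) \<and> card (b -` {n}) > 2 ^ (n + 1)\<^sup>2"
    using ex_blocks[of "\<lambda>n. 2 ^ (n + 1)\<^sup>2"] by blast
  then interpret blocks b
    by unfold_locales auto
  obtain \<Phi> where \<Phi>: "\<Phi> \<subseteq> slaloms" "|\<Phi>| =o \<kappa>"
    "\<And>f. (\<forall>n. f n < code_bound n) \<Longrightarrow> \<exists>\<phi>\<in>\<Phi>. \<forall>\<^sub>F n in sequentially. f n \<in> \<phi> n"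
    using 2(3) by metis
  obtain D where D: "D \<subseteq> PM'" "higson_directed D"
    "comp_equiv stone_cech (comp_sup (higson ` D))" "|D| \<le>o |\<Phi>|"
    using ex_directed_family[OF \<Phi>(1,3)] by blast
  let ?P = "\<lambda>\<kappa> :: (nat \<Rightarrow> nat \<Rightarrow> real) rel. \<exists>D. D \<subseteq> PM' \<and> higson_directed D \<and>
            comp_equiv stone_cech (comp_sup (higson ` D)) \<and> |D| =o \<kappa>"
  \<comment> \<open>The size of \<open>D\<close> is admissible for \<open>hp'\<close>, which rules
    out infinity and bounds the least such cardinal by \<open>|D|\<close>, hence by
    \<kappa>.\<close>
  have PD: "?P |D|"
    using D card_of_refl by blast
  have "hp' \<le>\<^sub>x Cardinal \<kappa>"
  proof (cases rule: least_cardinal_cases[of ?P])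
    case 1
    then show ?thesis
      using PD card_of_Card_order by blast
  next
    case (2 r)
    have "r \<le>o |D|"
      using 2(4) PD card_of_Card_order by blast
    then have "r \<le>o \<kappa>"
      using D(4) \<Phi>(2) ordLeq_transitive ordLeq_ordIso_trans by blast
    with 2(1) show ?thesis
      by (simp add: hp'_def)
  qed
  with 2(1) show ?thesis
    by (simp add: localization_number_def)
qed

end
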